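(* Let $1\le k<N$ be integers, let $b$ be a constant and $R>0$, and let $\Omega\subset\mathbb R^N$ be a bounded domain such that $B_R\subset\Omega$. Then: (a) if $bR\ge k$, there are no positive supersolutions of $$\mathcal P_k^+(D^2u)+b|Du|\le-1\quad\text{in }\Omega;$$ (b) if $bR>k$, there are no pairs $(\mu,\psi)\in(0,\infty)\times\mathrm{LSC}(\Omega)$ such that $$\mathcal P_k^+(D^2\psi)+b|D\psi|+\mu\psi\le0,\quad\psi>0\quad\text{in }\Omega,$$ i.e. $\overline\mu_k^+=\mu_k^+=0$, where $$\mu_k^+=\sup\{\mu\in\mathbb R:\exists\,\varphi\in\mathrm{LSC}(\Omega),\ \varphi>0,\ \mathcal P_k^+(D^2\varphi)+b|D\varphi|+\mu\varphi\le0\ \text{in }\Omega\},$$ $$\overline\mu_k^+=\sup\{\mu\in\mathbb R:\exists\,\varphi\in\mathrm{LSC}(\overline\Omega),\ \varphi>0\ \text{in }\overline\Omega,\ \mathcal P_k^+(D^2\varphi)+b|D\varphi|+\mu\varphi\le0\ \text{in }\Omega\}.$$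
   Context: $B_R\subset\mathbb R^N$ is the open ball of radius $R$ centered at the origin. For a symmetric $N\times N$ matrix $X$ with ordered eigenvalues $\lambda_1(X)\le\dots\le\lambda_N(X)$, $\mathcal P_k^+(X)=\sum_{i=1}^k\lambda_{N+1-i}(X)$. $\mathrm{LSC}$ denotes real-valued lower semicontinuous functions; supersolutions are lower semicontinuous in $\Omega$. Inequalities are in the viscosity sense: $u$ satisfies $\mathcal P_k^+(D^2u)+b|Du|+\mu u\le c$ in $\Omega$ if whenever $\varphi$ is $C^2$ near $x_0\in\Omega$ and $u-\varphi$ has a local minimum at $x_0$, then $\mathcal P_k^+(D^2\varphi(x_0))+b|D\varphi(x_0)|+\mu u(x_0)\le c$. *)

theory Defs
  imports "HOL-Analysis.Analysis" "HOL-Computational_Algebra.Polynomial"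
begin

definition charpoly :: "real ^ 'n ^ 'n \<Rightarrow> real poly" where
  "charpoly X = det (mat [:0, 1:] - (\<chi> i j. [:X $ i $ j:]))"

text \<open>
  \<open>eigval X i\<close>, for \<open>1 \<le> i \<le> CARD('n)\<close>, is the \<open>i\<close>-th eigenvalue in nondecreasing order, counted
  with multiplicity. It is meaningful for symmetric \<open>X\<close>, whose characteristic polynomial has
  exactly \<open>CARD('n)\<close> real roots.
\<close>
definition eigval :: "real ^ 'n ^ 'n \<Rightarrow> nat \<Rightarrow> real" where
  "eigval X i = sorted_list_of_multiset (proots (charpoly X)) ! (i - 1)"

definition Pk_plus :: "nat \<Rightarrow> real ^ 'n ^ 'n \<Rightarrow> real" where
  "Pk_plus k X = (\<Sum>i = 1..k. eigval X (CARD('n) + 1 - i))"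

definition lsc_on :: "('a :: topological_space) set \<Rightarrow> ('a \<Rightarrow> real) \<Rightarrow> bool" where
  "lsc_on S u \<longleftrightarrow> (\<forall>x\<in>S. \<forall>a < u x. \<forall>\<^sub>F y in at x within S. a < u y)"

text \<open>
  \<open>\<phi>\<close> is of class \<open>C\<^sup>2\<close> near \<open>x0\<close>, with gradient \<open>G\<close> and Hessian matrix \<open>H\<close> there. Both are uniquely
  determined near \<open>x0\<close>, and the Hessian is symmetric because it is continuous.
\<close>
definition C2_near ::
    "(real ^ 'n \<Rightarrow> real) \<Rightarrow> real ^ 'n \<Rightarrow> (real ^ 'n \<Rightarrow> real ^ 'n) \<Rightarrow> (real ^ 'n \<Rightarrow> real ^ 'n ^ 'n) \<Rightarrow> bool"
where
  "C2_near \<phi> x0 G H \<longleftrightarrow>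
    (\<exists>U. open U \<and> x0 \<in> U \<and> continuous_on U H \<and>
      (\<forall>x\<in>U. GDERIV \<phi> x :> G x \<and> (G has_derivative (\<lambda>h. H x *v h)) (at x)))"

definition local_min_at :: "('a :: topological_space \<Rightarrow> real) \<Rightarrow> 'a \<Rightarrow> bool" where
  "local_min_at f x0 \<longleftrightarrow> (\<forall>\<^sub>F x in nhds x0. f x0 \<le> f x)"

text \<open>
  \<open>visc_le k b \<mu> c \<Omega> u\<close> is \<open>P\<^sub>k\<^sup>+(D\<^sup>2u) + b |Du| + \<mu> u \<le> c\<close> in \<open>\<Omega>\<close> in the viscosity sense. It is used for open
  \<open>\<Omega>\<close>, so only the values of \<open>u\<close> in \<open>\<Omega>\<close> matter; lower semicontinuity of \<open>u\<close> is not part of it.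
\<close>
definition visc_le ::
    "nat \<Rightarrow> real \<Rightarrow> real \<Rightarrow> real \<Rightarrow> (real ^ 'n) set \<Rightarrow> (real ^ 'n \<Rightarrow> real) \<Rightarrow> bool"
where
  "visc_le k b \<mu> c \<Omega> u \<longleftrightarrow>
    (\<forall>x0\<in>\<Omega>. \<forall>\<phi> G H. C2_near \<phi> x0 G H \<longrightarrow> local_min_at (\<lambda>x. u x - \<phi> x) x0 \<longrightarrow>
      Pk_plus k (H x0) + b * norm (G x0) + \<mu> * u x0 \<le> c)"

definition mu_plus :: "nat \<Rightarrow> real \<Rightarrow> (real ^ 'n) set \<Rightarrow> ereal" where
  "mu_plus k b \<Omega> =
    (SUP \<mu>\<in>{\<mu> :: real. \<exists>\<phi>. lsc_on \<Omega> \<phi> \<and> (\<forall>x\<in>\<Omega>. 0 < \<phi> x) \<and> visc_le k b \<mu> 0 \<Omega> \<phi>}. ereal \<mu>)"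

definition mu_bar_plus :: "nat \<Rightarrow> real \<Rightarrow> (real ^ 'n) set \<Rightarrow> ereal" where
  "mu_bar_plus k b \<Omega> =
    (SUP \<mu>\<in>{\<mu> :: real. \<exists>\<phi>. lsc_on (closure \<Omega>) \<phi> \<and> (\<forall>x\<in>closure \<Omega>. 0 < \<phi> x) \<and>
      visc_le k b \<mu> 0 \<Omega> \<phi>}. ereal \<mu>)"

end

theory Submission
  imports Defs
begin

text \<open>
  Nonexistence. Let \<open>u\<close> be a supersolution on \<open>B\<^sub>R\<close> with right-hand side \<open>- \<gamma> < 0\<close> which is bounded
  below, and let \<open>c\<close> be its infimum. For small \<open>\<epsilon>\<close>, the functions \<open>c + \<epsilon> (1 - (|x| / R)\<^bsup>2P\<^esup>)\<close> satisfy
  \<open>P\<^sub>k\<^sup>+ + b |D| > - \<gamma>\<close> on \<open>B\<^sub>R\<close> uniformly in \<open>P\<close>: since \<open>k < N\<close>, only the tangential eigenvalue \<open>- a\<close> enters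
  \<open>P\<^sub>k\<^sup>+\<close>, the gradient has norm \<open>a |x|\<close>, and \<open>a (k - b |x|) \<le> a k (1 - |x| / R)\<close> stays bounded by a
  multiple of \<open>\<epsilon>\<close> because \<open>P t\<^bsup>2P - 2\<^esup> (1 - t) \<le> 1\<close>. As \<open>P \<rightarrow> \<infinity>\<close> they converge to \<open>c + \<epsilon>\<close> inside \<open>B\<^sub>R\<close>,
  so one of them must touch \<open>u - const\<close> from below in the ball, which is a contradiction. If
  \<open>b R > k\<close>, a positive \<open>\<psi>\<close> with \<open>\<mu> > 0\<close> is such a supersolution on a smaller ball, with
  \<open>\<gamma> = \<mu> min \<psi>\<close>.

  That the suprema are \<open>0\<close> and not smaller is witnessed by constants. This uses the symmetry of the
  Hessian and the spectral theorem, so that the characteristic polynomial really has \<open>N\<close> real roots.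
\<close>

subsection \<open>Eigenvalues of symmetric matrices\<close>

text \<open>A maximiser \<open>v\<close> of \<open>f x \<bullet> x\<close> on the compact unit
  sphere of \<open>S\<close> is an eigenvector: otherwise moving from \<open>v\<close> along the
  residual \<open>f v - l *\<^sub>R v\<close>, which stays in \<open>S\<close>, would make
  \<open>f x \<bullet> x - l * (x \<bullet> x)\<close> positive to first order.\<close>

lemma self_adjoint_eigenvector_in_subspace:
  fixes f :: "'a::euclidean_space \<Rightarrow> 'a"
  assumes "linear f" and sa: "\<And>x y. f x \<bullet> y = x \<bullet> f y"
    and S: "subspace S" and inv: "\<And>x. x \<in> S \<Longrightarrow> f x \<in> S" and nz: "\<exists>x\<in>S. x \<noteq> 0"
  obtains v l where "v \<in> S" "norm v = 1" "f v = l *\<^sub>R v"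
proof -
  let ?K = "S \<inter> sphere 0 1"
  have "compact ?K"
    using S by (simp add: closed_Int_compact closed_subspace)
  moreover have "?K \<noteq> {}"
  proof -
    obtain x where "x \<in> S" "x \<noteq> 0" using nz by blast
    then have "x /\<^sub>R norm x \<in> ?K" using S by (simp add: subspace_scale)
    then show ?thesis by blast
  qed
  moreover have "continuous_on ?K (\<lambda>x. f x \<bullet> x)"
    using \<open>linear f\<close> by (intro continuous_intros linear_continuous_on linear_conv_bounded_linear[THEN iffD1])
  ultimately obtain v where v: "v \<in> ?K" and max: "\<And>y. y \<in> ?K \<Longrightarrow> f y \<bullet> y \<le> f v \<bullet> v"
    using continuous_attains_sup[of ?K "\<lambda>x. f x \<bullet> x"] by blast
  define l where "l = f v \<bullet> v"
  have vS: "v \<in> S" and vv: "v \<bullet> v = 1" and nv: "norm v = 1"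
    using v by (auto simp: norm_eq_1)
  have nonneg: "f y \<bullet> y \<le> l * (y \<bullet> y)" if "y \<in> S" for y
  proof (cases "y = 0")
    case False
    have "y /\<^sub>R norm y \<in> ?K" using that S False by (simp add: subspace_scale)
    from max[OF this] have "(f y \<bullet> y) / (norm y * norm y) \<le> l"
      using \<open>linear f\<close> by (simp add: l_def linear_scale divide_inverse mult_ac)
    then show ?thesis using False
      by (simp add: divide_le_eq dot_square_norm power2_eq_square)
  qed (use \<open>linear f\<close> in \<open>simp add: linear_0\<close>)
  define w where "w = f v - l *\<^sub>R v"
  have wS: "w \<in> S" using S vS inv by (simp add: w_def subspace_diff subspace_scale)
  \<comment> \<open>Expand \<open>nonneg\<close> at \<open>v + t *\<^sub>R w\<close>: the
    zeroth-order terms agree because \<open>v\<close> is a unit vector, and the first-order terms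
    combine to \<open>2 * t * (w \<bullet> w)\<close>.\<close>
  have quad: "2 * t * (w \<bullet> w) \<le> t\<^sup>2 * (l * (w \<bullet> w) - f w \<bullet> w)" for t
  proof -
    have "v + t *\<^sub>R w \<in> S" using S vS wS by (simp add: subspace_add subspace_scale)
    from nonneg[OF this]
    have "l + 2 * t * (f v \<bullet> w) + t\<^sup>2 * (f w \<bullet> w) \<le> l + 2 * t * (l * (v \<bullet> w)) + t\<^sup>2 * (l * (w \<bullet> w))"
      using \<open>linear f\<close> sa[of w v] vv
      by (simp add: linear_add linear_scale l_def inner_commute algebra_simps power2_eq_square)
    moreover have "2 * t * (w \<bullet> w) = 2 * t * (f v \<bullet> w) - 2 * t * (l * (v \<bullet> w))"
    proof -
      have "w \<bullet> w = f v \<bullet> w - l * (v \<bullet> w)"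
        by (subst (1) w_def) (simp add: inner_diff_left)
      then show ?thesis by (simp only: right_diff_distrib)
    qed
    ultimately show ?thesis unfolding right_diff_distrib[of "t\<^sup>2"] by linarith
  qed
  have "w \<bullet> w = 0"
  proof (rule ccontr)
    assume "w \<bullet> w \<noteq> 0"
    then have pos: "w \<bullet> w > 0" by simp
    define C where "C = \<bar>l * (w \<bullet> w) - f w \<bullet> w\<bar> + 1"
    have "C > 0" by (simp add: C_def)
    \<comment> \<open>With this \<open>t\<close> the quadratic bound \<open>t\<^sup>2 * C\<close> is
      \<open>t * (w \<bullet> w)\<close>, only half of the linear term.\<close>
    define t where "t = w \<bullet> w / C"
    have "t > 0" using pos \<open>C > 0\<close> by (simp add: t_def)
    have "2 * t * (w \<bullet> w) \<le> t\<^sup>2 * C"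
      using quad[of t] by (rule order_trans) (intro mult_left_mono, auto simp: C_def)
    also have "\<dots> = t * (w \<bullet> w)"
      using \<open>C > 0\<close> by (simp add: t_def power2_eq_square)
    finally show False using \<open>t > 0\<close> pos by (simp add: zero_less_mult_iff)
  qed
  then have "f v = l *\<^sub>R v" by (simp add: w_def)
  then show thesis using that vS nv by blast
qed

text \<open>Take an orthonormal set of eigenvectors of largest cardinality. Its orthogonal
  complement is invariant under \<open>f\<close> by self-adjointness, so a nonzero complement would
  contain one more eigenvector.\<close>

lemma self_adjoint_orthonormal_eigenbasis:
  fixes f :: "'a::euclidean_space \<Rightarrow> 'a"
  assumes lin: "linear f" and sa: "\<And>x y. f x \<bullet> y = x \<bullet> f y"
  obtains B where "pairwise orthogonal B" "card B = DIM('a)"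
    "\<And>v. v \<in> B \<Longrightarrow> norm v = 1" "\<And>v. v \<in> B \<Longrightarrow> \<exists>l. f v = l *\<^sub>R v"
proof -
  define P where "P B \<longleftrightarrow> pairwise orthogonal B \<and> (\<forall>v\<in>B. norm v = 1 \<and> (\<exists>l. f v = l *\<^sub>R v))"
    for B
  have bound: "finite B \<and> card B \<le> DIM('a)" if "P B" for B
  proof -
    have "independent B"
      using that by (intro pairwise_orthogonal_independent) (auto simp: P_def)
    then show ?thesis by (rule independent_bound)
  qed
  have "P {}" by (simp add: P_def)
  have "\<exists>B. P B \<and> (\<forall>B'. P B' \<longrightarrow> card B' \<le> card B)"
    using ex_has_greatest_nat[of P "{}" card "Suc DIM('a)"] \<open>P {}\<close> bound
    by (auto simp: less_Suc_eq_le)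
  then obtain B where B: "P B" and maximal: "\<And>B'. P B' \<Longrightarrow> card B' \<le> card B" by blast
  have "card B = DIM('a)"
  proof (rule ccontr)
    assume "card B \<noteq> DIM('a)"
    with bound[OF B] have "card B < DIM('a)" by simp
    then have "dim B < DIM('a)"
      using bound[OF B] dim_le_card'[of B] by simp
    then obtain x where x: "x \<noteq> 0" "\<And>y. y \<in> span B \<Longrightarrow> orthogonal x y"
      using orthogonal_to_subspace_exists by blast
    define S where "S = {x. \<forall>y\<in>B. y \<bullet> x = 0}"
    have "subspace S"
      by (auto simp: S_def subspace_def inner_simps)
    moreover have "f z \<in> S" if "z \<in> S" for z
    proof -
      have "y \<bullet> f z = 0" if "y \<in> B" for y
      proof -
        obtain l where "f y = l *\<^sub>R y" using B \<open>y \<in> B\<close> by (auto simp: P_def)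
        then show ?thesis using sa[of y z] \<open>z \<in> S\<close> \<open>y \<in> B\<close> by (simp add: S_def)
      qed
      then show ?thesis by (simp add: S_def)
    qed
    moreover have "\<exists>z\<in>S. z \<noteq> 0"
      using x by (intro bexI[of _ x]) (auto simp: S_def orthogonal_def inner_commute[of _ x] span_base)
    ultimately obtain v l where v: "v \<in> S" "norm v = 1" "f v = l *\<^sub>R v"
      using self_adjoint_eigenvector_in_subspace[OF lin sa] by metis
    have "v \<notin> B" using v by (auto simp: S_def)
    have "P (insert v B)"
      using B v by (auto simp: P_def pairwise_insert orthogonal_def S_def inner_commute)
    from maximal[OF this] show False
      using \<open>v \<notin> B\<close> bound[OF B] by simp
  qed
  with B show thesis using that by (auto simp: P_def)
qed

section \<open>The characteristic polynomial and its roots\<close>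

lemma poly_det: "poly (det A) x = det (\<chi> i j. poly (A $ i $ j) x)"
  by (simp add: det_def poly_sum poly_prod)

text \<open>Both sides agree as functions of \<open>t\<close>: conjugation by the orthogonal matrix
  of eigenvectors turns \<open>t I - X\<close> into the diagonal matrix with entries
  \<open>t - d i\<close>.\<close>

lemma charpoly_eqI_eigenbasis:
  fixes X :: "real ^ 'n ^ 'n" and v :: "'n \<Rightarrow> real ^ 'n"
  assumes orth: "\<And>i j. v i \<bullet> v j = (if i = j then 1 else 0)"
    and eig: "\<And>i. X *v v i = d i *\<^sub>R v i"
  shows "charpoly X = (\<Prod>i\<in>UNIV. [:- d i, 1:])"
proof -
  have "poly (charpoly X) t = poly (\<Prod>i\<in>UNIV. [:- d i, 1:]) t" for t
  proof -
    \<comment> \<open>The eigenvectors are the rows of \<open>V\<close>, hence the columns of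
      \<open>transpose V\<close>.\<close>
    define V :: "real ^ 'n ^ 'n" where "V = (\<chi> i j. v i $ j)"
    define D :: "real ^ 'n ^ 'n" where "D = (\<chi> i j. if i = j then t - d i else 0)"
    have VV: "V ** transpose V = mat 1"
      using orth by (simp add: V_def matrix_matrix_mult_def transpose_def mat_def vec_eq_iff inner_vec_def)
    have "(t *\<^sub>R mat 1 - X) ** transpose V = transpose V ** D"
    proof -
      have "(\<Sum>k\<in>UNIV. (t *\<^sub>R mat 1 - X) $ i $ k * v j $ k) = v j $ i * (t - d j)" for i j
      proof -
        have "(\<Sum>k\<in>UNIV. (t *\<^sub>R mat 1 - X) $ i $ k * v j $ k)
            = ((t *\<^sub>R mat 1 - X) *v v j) $ i"
          by (simp add: matrix_vector_mult_def)
        also have "\<dots> = t * v j $ i - d j * v j $ i"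
          using eig[of j]
          by (simp add: matrix_vector_mult_diff_rdistrib scaleR_matrix_vector_assoc[symmetric])
        finally show ?thesis by (simp add: algebra_simps)
      qed
      then show ?thesis
        by (simp add: V_def D_def matrix_matrix_mult_def transpose_def vec_eq_iff if_distrib cong: if_cong)
    qed
    then have "det (t *\<^sub>R mat 1 - X) * det V = det V * det D"
      by (metis det_mul det_transpose)
    moreover have "det V * det V = 1"
      using VV by (metis det_mul det_transpose det_I)
    ultimately have "det (t *\<^sub>R mat 1 - X) = det D"
      by (metis mult.commute mult_cancel_left mult_zero_left zero_neq_one)
    moreover have "poly (charpoly X) t = det (t *\<^sub>R mat 1 - X)"
      unfolding charpoly_def poly_det
      by (rule arg_cong[where f = det]) (simp add: vec_eq_iff mat_def)
    moreover have "det D = (\<Prod>i\<in>UNIV. t - d i)"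
      by (subst det_diagonal) (simp_all add: D_def)
    ultimately show ?thesis by (simp add: poly_prod)
  qed
  then show ?thesis using poly_eq_poly_eq_iff by blast
qed

text \<open>Links \<open>eigval\<close>, which sorts the roots of the characteristic polynomial, to
  eigenvectors: the list has exactly \<open>CARD('n)\<close> entries, and each is the eigenvalue of
  some \<open>v i\<close>.\<close>

lemma symmetric_matrix_spectrum:
  fixes X :: "real ^ 'n ^ 'n"
  assumes "\<And>x y. (X *v x) \<bullet> y = x \<bullet> (X *v y)"
  obtains v :: "'n \<Rightarrow> real ^ 'n" and d
  where "\<forall>i j. v i \<bullet> v j = (if i = j then 1 else 0)" "\<forall>i. X *v v i = d i *\<^sub>R v i"
    "proots (charpoly X) = image_mset d (mset_set UNIV)"
proof -
  obtain B :: "(real ^ 'n) set" where B: "pairwise orthogonal B" "card B = CARD('n)"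
    "\<And>v. v \<in> B \<Longrightarrow> norm v = 1" "\<And>v. v \<in> B \<Longrightarrow> \<exists>l. X *v v = l *\<^sub>R v"
    using self_adjoint_orthonormal_eigenbasis[of "(*v) X"] assms by auto
  have "finite B" using B(2) by (simp add: card_ge_0_finite)
  then obtain v :: "'n \<Rightarrow> real ^ 'n" where v: "bij_betw v UNIV B"
    using finite_same_card_bij[of "UNIV :: 'n set" B] B(2) by auto
  have vB: "v i \<in> B" for i using v by (auto simp: bij_betw_def)
  have "\<forall>i. \<exists>l. X *v v i = l *\<^sub>R v i" using B(4) vB by blast
  then obtain d where d: "\<And>i. X *v v i = d i *\<^sub>R v i" by (auto dest!: choice)
  have orth: "v i \<bullet> v j = (if i = j then 1 else 0)" for i j
  proof (cases "i = j")
    case True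
    then show ?thesis using B(3)[OF vB[of i]] by (simp add: norm_eq_1)
  next
    case False
    then have "v i \<noteq> v j" using v by (metis UNIV_I bij_betw_def inj_on_def)
    then show ?thesis using B(1) vB[of i] vB[of j] False by (auto simp: pairwise_def orthogonal_def)
  qed
  have "proots (charpoly X) = (\<Sum>i\<in>UNIV. {#d i#})"
    unfolding charpoly_eqI_eigenbasis[OF orth d] by (simp add: proots_prod)
  also have "\<dots> = image_mset d (mset_set UNIV)"
    by (simp add: sum_unfold_sum_mset)
  finally show thesis using that[of v d] orth d by simp
qed

section \<open>Bounds for \<open>Pk_plus\<close>\<close>

lemma Pk_plus_nonpos:
  fixes X :: "real ^ 'n ^ 'n"
  assumes sym: "\<And>x y. (X *v x) \<bullet> y = x \<bullet> (X *v y)" and neg: "\<And>x. x \<bullet> (X *v x) \<le> 0"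
    and "k \<le> CARD('n)"
  shows "Pk_plus k X \<le> 0"
proof -
  obtain v :: "'n \<Rightarrow> real ^ 'n" and d where v: "\<forall>i j. v i \<bullet> v j = (if i = j then 1 else 0)" "\<forall>i. X *v v i = d i *\<^sub>R v i"
    and roots: "proots (charpoly X) = image_mset d (mset_set UNIV)"
    using symmetric_matrix_spectrum[OF sym] by blast
  define L where "L = sorted_list_of_multiset (proots (charpoly X))"
  have "d i \<le> 0" for i using neg[of "v i"] v by simp
  then have "x \<le> 0" if "x \<in> set L" for x using that by (auto simp: L_def roots)
  moreover have "length L = CARD('n)"
    by (simp add: L_def roots flip: size_mset)
  \<comment> \<open>The zero-based position read by \<open>eigval\<close> is
    \<open>CARD('n) - i\<close>. It lies inside the list because
    \<open>1 \<le> i \<le> k \<le> CARD('n)\<close>, so \<open>!\<close> is never applied out of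
    range.\<close>
  ultimately have "eigval X (CARD('n) + 1 - i) \<le> 0" if "i \<in> {1..k}" for i
    using that assms(3) unfolding eigval_def L_def[symmetric] by (auto intro!: nth_mem)
  then show ?thesis unfolding Pk_plus_def by (rule sum_nonpos)
qed

text \<open>Such an \<open>X\<close> is the Hessian of a radial function. It acts as
  \<open>- a\<close> on the complement of \<open>y\<close>, so at most one eigenvalue lies below
  \<open>- a\<close>, and a sum of \<open>k < N\<close> largest eigenvalues never includes
  it.\<close>

lemma Pk_plus_rank_one_perturbation:
  fixes y :: "real ^ 'n"
  assumes X: "\<And>h. X *v h = - a *\<^sub>R h - (e * (y \<bullet> h)) *\<^sub>R y" and "k < CARD('n)"
  shows "- (real k * a) \<le> Pk_plus k X"
proof -
  have sym: "(X *v x) \<bullet> z = x \<bullet> (X *v z)" for x z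
    by (simp add: X inner_simps inner_commute mult_ac)
  obtain v :: "'n \<Rightarrow> real ^ 'n" and d where v: "\<forall>i j. v i \<bullet> v j = (if i = j then 1 else 0)" "\<forall>i. X *v v i = d i *\<^sub>R v i"
    and roots: "proots (charpoly X) = image_mset d (mset_set UNIV)"
    using symmetric_matrix_spectrum[OF sym] by blast
  define L where "L = sorted_list_of_multiset (proots (charpoly X))"
  have "sorted L" by (simp add: L_def)
  have len: "length L = CARD('n)"
    by (simp add: L_def roots flip: size_mset)
  \<comment> \<open>An eigenvector with eigenvalue other than \<open>- a\<close> is a multiple of
    \<open>y\<close>; two orthogonal nonzero vectors cannot both be.\<close>
  have same: "i = j" if "d i < - a" "d j < - a" for i j
  proof (rule ccontr)
    assume "i \<noteq> j"
    have eq: "(e * (y \<bullet> v i)) *\<^sub>R y = (- a - d i) *\<^sub>R v i" for i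
      using v(2)[rule_format, of i] X[of "v i"] by (simp add: algebra_simps)
    have "0 = (- a - d i) * (v i \<bullet> v j)" using v(1) \<open>i \<noteq> j\<close> by simp
    also have "\<dots> = e * (y \<bullet> v i) * (y \<bullet> v j)"
      using arg_cong[OF eq[of i], of "\<lambda>x. x \<bullet> v j"] by simp
    finally have "e * (y \<bullet> v i) = 0 \<or> e * (y \<bullet> v j) = 0" by auto
    then have "(- a - d i) *\<^sub>R v i = 0 \<or> (- a - d j) *\<^sub>R v j = 0"
      using eq[of i] eq[of j] by auto
    moreover have "v i \<noteq> 0" "v j \<noteq> 0" using v(1)[rule_format, of i i] v(1)[rule_format, of j j] by auto
    ultimately show False using that by auto
  qed
  have "card {i. d i < - a} \<le> 1"
    unfolding One_nat_def by (subst card_le_Suc0_iff_eq) (use same in auto)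
  moreover have "length (filter (\<lambda>x. x < - a) L) = card {i. d i < - a}"
  proof -
    have "length (filter (\<lambda>x. x < - a) L) = size (filter_mset (\<lambda>x. x < - a) (mset L))"
      by (simp flip: mset_filter)
    also have "\<dots> = card {i. d i < - a}"
      by (simp add: L_def roots filter_mset_image_mset)
    finally show ?thesis .
  qed
  ultimately have few: "length (filter (\<lambda>x. x < - a) L) \<le> 1" by simp
  \<comment> \<open>An entry below \<open>- a\<close> at a position after the first would, by
    sortedness, come with a second one at position 0. The positions \<open>CARD('n) - i\<close> used
    below are at least 1 because \<open>i \<le> k < CARD('n)\<close>.\<close>
  have big: "- a \<le> L ! n" if "1 \<le> n" "n < CARD('n)" for n
  proof (rule ccontr)
    assume "\<not> - a \<le> L ! n"
    moreover have "L ! 0 \<le> L ! n" using \<open>sorted L\<close> that len by (intro sorted_nth_mono) auto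
    ultimately have "{0, n} \<subseteq> {i. i < length L \<and> L ! i < - a}" using that len by auto
    then have "card {0, n} \<le> card {i. i < length L \<and> L ! i < - a}" by (intro card_mono) auto
    with few that show False by (simp add: length_filter_conv_card)
  qed
  have "(\<Sum>i = 1..k. - a) \<le> Pk_plus k X"
    unfolding Pk_plus_def
  proof (rule sum_mono)
    fix i assume "i \<in> {1..k}"
    then show "- a \<le> eigval X (CARD('n) + 1 - i)"
      using big[of "CARD('n) - i"] assms(2) unfolding eigval_def L_def[symmetric] by auto
  qed
  then show ?thesis by simp
qed

subsection \<open>Supersolutions on a ball\<close>

text \<open>If no minimum existed, every \<open>x\<close> would have a better point
  \<open>g x\<close> and a neighbourhood on which \<open>f\<close> exceeds \<open>f (g x)\<close>.
  In a finite subcover pick the centre \<open>c\<close> with least \<open>f (g c)\<close>: the point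
  \<open>g c\<close> lies in some \<open>U c'\<close>, which makes \<open>f (g c')\<close> smaller
  still.\<close>

lemma lsc_on_attains_inf:
  fixes K :: "'a::topological_space set"
  assumes "compact K" "K \<noteq> {}" and lsc: "lsc_on K f"
  shows "\<exists>x\<in>K. \<forall>y\<in>K. f x \<le> f y"
proof (rule ccontr)
  assume "\<not> ?thesis"
  then have "\<forall>x\<in>K. \<exists>y. y \<in> K \<and> f y < f x"
    by (metis not_le_imp_less)
  then obtain g where g: "\<And>x. x \<in> K \<Longrightarrow> g x \<in> K \<and> f (g x) < f x"
    by metis
  \<comment> \<open>The filter in \<open>lsc_on\<close> omits \<open>x\<close> itself; there the
    inequality is the assumption \<open>f y < f x\<close>.\<close>
  have nbhd: "\<exists>U. open U \<and> x \<in> U \<and> (\<forall>z\<in>U \<inter> K. f y < f z)" if "x \<in> K" "f y < f x" for x y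
  proof -
    have "\<forall>\<^sub>F z in at x within K. f y < f z"
      using lsc that by (simp add: lsc_on_def)
    then obtain U where "open U" "x \<in> U" "\<And>z. z \<in> U \<Longrightarrow> z \<noteq> x \<Longrightarrow> z \<in> K \<Longrightarrow> f y < f z"
      unfolding eventually_at_topological by blast
    then show ?thesis using that by (metis IntE)
  qed
  have "\<exists>U. open U \<and> x \<in> U \<and> (\<forall>z\<in>U \<inter> K. f (g x) < f z)" if "x \<in> K" for x
    using nbhd[OF that] g[OF that] by blast
  then obtain U where U: "\<And>x. x \<in> K \<Longrightarrow> open (U x)" "\<And>x. x \<in> K \<Longrightarrow> x \<in> U x"
    and gU: "\<And>x z. x \<in> K \<Longrightarrow> z \<in> U x \<inter> K \<Longrightarrow> f (g x) < f z"
    by metis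
  have "K \<subseteq> (\<Union>x\<in>K. U x)" using U by blast
  then obtain C where C: "C \<subseteq> K" "finite C" "K \<subseteq> (\<Union>x\<in>C. U x)"
    using \<open>compact K\<close> U(1) by (metis compactE_image)
  have "C \<noteq> {}" using C \<open>K \<noteq> {}\<close> by auto
  then obtain c where c: "c \<in> C" "\<And>c'. c' \<in> C \<Longrightarrow> f (g c) \<le> f (g c')"
    using C(2) arg_min_if_finite(1)[of C "\<lambda>c. f (g c)"] arg_min_least[of C _ "\<lambda>c. f (g c)"]
    by blast
  then obtain c' where "c' \<in> C" "g c \<in> U c'" using C g by blast
  then have "f (g c') < f (g c)" using gU[of c' "g c"] g C c by blast
  with c(2)[OF \<open>c' \<in> C\<close>] show False by simp
qed

lemma lsc_on_subset: "lsc_on T f \<Longrightarrow> S \<subseteq> T \<Longrightarrow> lsc_on S f"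
  unfolding lsc_on_def by (blast intro: filter_leD[OF at_le])

lemma lsc_on_diff_continuous:
  fixes f :: "'a::topological_space \<Rightarrow> real"
  assumes f: "lsc_on S f" and g: "continuous_on S g"
  shows "lsc_on S (\<lambda>x. f x - g x)"
  unfolding lsc_on_def
proof (intro ballI allI impI)
  fix x a assume x: "x \<in> S" and "a < f x - g x"
  define e where "e = (f x - g x - a) / 2"
  have "e > 0" using \<open>a < f x - g x\<close> by (simp add: e_def)
  have "\<forall>\<^sub>F y in at x within S. f x - e < f y"
    using f x \<open>e > 0\<close> by (simp add: lsc_on_def)
  moreover have "\<forall>\<^sub>F y in at x within S. g y < g x + e"
    using g x \<open>e > 0\<close> by (intro order_tendstoD(2)[of g "g x"]) (auto simp: continuous_on)
  ultimately show "\<forall>\<^sub>F y in at x within S. a < f y - g y"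
  proof eventually_elim
    case (elim y)
    then show ?case unfolding e_def by argo
  qed
qed

lemma lsc_on_const: "lsc_on S (\<lambda>x. c)"
  by (simp add: lsc_on_def)

lemma visc_le_subset: "visc_le k b \<mu> c T u \<Longrightarrow> S \<subseteq> T \<Longrightarrow> visc_le k b \<mu> c S u"
  unfolding visc_le_def by blast

text \<open>The \<open>n + 1\<close> copies of \<open>t ^ n\<close> are dominated by the geometric
  sum, which telescopes against \<open>1 - t\<close>. The bound is uniform in \<open>n\<close>, so
  the exponent of the test function can be taken as large as desired.\<close>

lemma power_times_one_minus_le:
  fixes t :: real
  assumes "0 \<le> t" "t \<le> 1"
  shows "real (Suc n) * (t ^ n * (1 - t)) \<le> 1"
proof -
  have "real (Suc n) * t ^ n = (\<Sum>i<Suc n. t ^ n)" by simp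
  also have "\<dots> \<le> (\<Sum>i<Suc n. t ^ i)"
    using assms by (intro sum_mono power_decreasing) auto
  finally have "real (Suc n) * t ^ n * (1 - t) \<le> (\<Sum>i<Suc n. t ^ i) * (1 - t)"
    using assms by (intro mult_right_mono) auto
  also have "\<dots> = 1 - t ^ Suc n"
    by (metis mult.commute one_diff_power_eq)
  also have "\<dots> \<le> 1" using assms by simp
  finally show ?thesis by (simp add: mult.assoc)
qed

text \<open>The chain rule for \<open>g\<close> composed with the squared norm, which is smooth at
  the origin too. The second conclusion exhibits the Hessian as a multiple of the identity plus a
  rank-one term.\<close>

lemma C2_near_radial:
  fixes x0 y :: "real ^ 'n"
  assumes g: "\<And>t. (g has_real_derivative g' t) (at t)"
    and g': "\<And>t. (g' has_real_derivative g'' t) (at t)"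
    and "continuous_on UNIV g''"
  shows "C2_near (\<lambda>x. g (x \<bullet> x)) x0 (\<lambda>x. (2 * g' (x \<bullet> x)) *\<^sub>R x)
    (\<lambda>x. (2 * g' (x \<bullet> x)) *\<^sub>R mat 1 + (4 * g'' (x \<bullet> x)) *\<^sub>R (\<chi> i j. x $ i * x $ j))"
    (is "C2_near ?f x0 ?G ?H")
    and "((2 * g' (y \<bullet> y)) *\<^sub>R mat 1 + (4 * g'' (y \<bullet> y)) *\<^sub>R (\<chi> i j. y $ i * y $ j)) *v h
      = (2 * g' (y \<bullet> y)) *\<^sub>R h + (4 * g'' (y \<bullet> y) * (y \<bullet> h)) *\<^sub>R y"
proof -
  have outer: "(\<chi> i j. y $ i * y $ j) *v h = (y \<bullet> h) *\<^sub>R y" for y h :: "real ^ 'n"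
    by (simp add: vec_eq_iff matrix_vector_mult_def inner_vec_def sum_distrib_left sum_distrib_right mult_ac)
  have Hv: "?H y *v h = (2 * g' (y \<bullet> y)) *\<^sub>R h + (4 * g'' (y \<bullet> y) * (y \<bullet> h)) *\<^sub>R y" for y h
    by (simp add: matrix_vector_mult_add_rdistrib scaleR_matrix_vector_assoc[symmetric] outer)
  then show "?H y *v h = (2 * g' (y \<bullet> y)) *\<^sub>R h + (4 * g'' (y \<bullet> y) * (y \<bullet> h)) *\<^sub>R y" .
  have "continuous_on UNIV g'"
    using g' by (meson DERIV_isCont continuous_at_imp_continuous_on)
  have radial: "continuous_on UNIV (\<lambda>x :: real ^ 'n. f (x \<bullet> x))" if "continuous_on UNIV f" for f :: "real \<Rightarrow> real"
    by (rule continuous_on_compose2[OF that]) (auto intro!: continuous_intros)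
  have "continuous_on UNIV ?H"
    by (intro continuous_on_add continuous_on_scaleR continuous_on_mult continuous_on_const
      continuous_on_vec_lambda continuous_on_component continuous_on_id
      radial[OF \<open>continuous_on UNIV g'\<close>] radial[OF \<open>continuous_on UNIV g''\<close>])
  moreover have "GDERIV ?f x :> ?G x" for x
  proof -
    have "GDERIV (\<lambda>x. x \<bullet> x) x :> 2 *\<^sub>R x"
      unfolding gderiv_def
      by (rule has_derivative_eq_rhs, (rule derivative_eq_intros refl)+)
        (auto simp: fun_eq_iff inner_commute)
    from GDERIV_DERIV_compose[OF this g] show ?thesis by (simp add: mult.commute)
  qed
  moreover have "(?G has_derivative (\<lambda>h. ?H x *v h)) (at x)" for x
  proof -
    have "((\<lambda>x. g' (x \<bullet> x)) has_derivative (\<lambda>h. g'' (x \<bullet> x) * (2 * (x \<bullet> h)))) (at x)"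
      by (rule has_derivative_eq_rhs,
          rule has_derivative_compose[of "\<lambda>x. x \<bullet> x", OF _ has_field_derivative_imp_has_derivative[OF g']],
          (rule derivative_eq_intros refl)+)
        (auto simp: fun_eq_iff inner_commute)
    note this[derivative_intros]
    show ?thesis unfolding Hv
      by (rule has_derivative_eq_rhs, (rule derivative_eq_intros refl)+)
        (auto simp: fun_eq_iff algebra_simps)
  qed
  ultimately show "C2_near ?f x0 ?G ?H" unfolding C2_near_def by (intro exI[of _ UNIV]) auto
qed

text \<open>Only a lower bound is asked of \<open>u\<close>, so that the lemma applies to a positive
  supersolution with \<open>m = 0\<close> and \<open>\<gamma> = 1\<close>, and to
  \<open>\<psi>\<close> on a smaller ball with \<open>m\<close> its minimum there.\<close>

lemma no_supersolution_on_ball: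
  fixes u :: "real ^ 'n \<Rightarrow> real"
  assumes "k < CARD('n)" "0 < R" "real k \<le> b * R" "0 < \<gamma>"
    and lsc: "lsc_on (ball 0 R) u" and bdd: "\<And>x. x \<in> ball 0 R \<Longrightarrow> m \<le> u x"
    and visc: "visc_le k b 0 (- \<gamma>) (ball 0 R) u"
  shows False
proof -
  let ?B = "ball 0 R :: (real ^ 'n) set"
  define c where "c = Inf (u ` ?B)"
  have "bdd_below (u ` ?B)" using bdd by (intro bdd_belowI2[of _ m]) auto
  then have c_le: "c \<le> u x" if "x \<in> ?B" for x
    using that by (auto simp: c_def intro: cInf_lower)
  \<comment> \<open>Chosen so that the final bound \<open>2 * \<epsilon> * \<rho> * real k\<close>
    is less than \<open>\<gamma>\<close>.\<close>
  define \<epsilon> where "\<epsilon> = \<gamma> * R\<^sup>2 / (4 * (real k + 1))"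
  have "\<epsilon> > 0" using assms by (simp add: \<epsilon>_def)
  have "?B \<noteq> {}" using \<open>0 < R\<close> by auto
  then obtain x1 where x1: "x1 \<in> ?B" "u x1 < c + \<epsilon> / 2"
    using cInf_lessD[of "u ` ?B" "c + \<epsilon> / 2"] \<open>\<epsilon> > 0\<close> by (auto simp: c_def[symmetric])
  define \<rho> where "\<rho> = 1 / R\<^sup>2"
  have "\<rho> > 0" using \<open>0 < R\<close> by (simp add: \<rho>_def)
  define \<theta> where "\<theta> x = (x \<bullet> x) * \<rho>" for x :: "real ^ 'n"
  have \<theta>_eq: "\<theta> x = (norm x / R)\<^sup>2" for x
    by (simp add: \<theta>_def \<rho>_def power_divide power2_norm_eq_inner)
  have \<theta>_nonneg: "0 \<le> \<theta> x" for x by (simp add: \<theta>_eq)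
  have "\<theta> x1 < 1"
    using x1 \<open>0 < R\<close> by (simp add: \<theta>_eq power_less_one_iff)
  \<comment> \<open>The exponent depends on the nearly minimising point \<open>x1\<close>: there the
    test function must come close to its peak \<open>c + \<epsilon>\<close>. The test function uses
    \<open>n + 2\<close>, so that two differentiations leave the exponent \<open>n\<close>.\<close>
  then obtain n where "\<theta> x1 ^ n < 1 / 4"
    using real_arch_pow_inv[of "1/4" "\<theta> x1"] by auto
  moreover have "\<theta> x1 ^ Suc (Suc n) \<le> \<theta> x1 ^ n"
    using \<theta>_nonneg \<open>\<theta> x1 < 1\<close> by (intro power_decreasing) auto
  ultimately have small: "\<theta> x1 ^ Suc (Suc n) < 1 / 4" by linarith
  let ?P = "Suc (Suc n)"
  define g where "g t = c + \<epsilon> * (1 - (t * \<rho>) ^ ?P)" for t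
  define g' where "g' t = - (\<epsilon> * \<rho> * real ?P * (t * \<rho>) ^ Suc n)" for t
  define g'' where "g'' t = - (\<epsilon> * \<rho> * \<rho> * real ?P * real (Suc n) * (t * \<rho>) ^ n)" for t
  define \<phi> where "\<phi> x = g (x \<bullet> x)" for x :: "real ^ 'n"
  have dg: "(g has_real_derivative g' t) (at t)" for t
    unfolding g_def[abs_def] g'_def by (rule derivative_eq_intros refl)+ simp
  have dg': "(g' has_real_derivative g'' t) (at t)" for t
    unfolding g'_def[abs_def] g''_def by (rule derivative_eq_intros refl)+ simp
  have contg: "continuous_on UNIV g''"
    unfolding g''_def[abs_def] by (intro continuous_intros)
  have \<phi>_eq: "\<phi> x = c + \<epsilon> * (1 - \<theta> x ^ ?P)" for x
    by (simp only: \<phi>_def g_def \<theta>_def)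
  have cont_\<theta>: "continuous_on S (\<lambda>x. \<theta> x ^ ?P)" for S
    unfolding \<theta>_def by (intro continuous_intros)
  \<comment> \<open>\<open>K\<close> is the part of the closed ball where
    \<open>\<phi> \<ge> c + \<epsilon> / 4\<close>. It avoids the sphere, where
    \<open>\<theta> = 1\<close>, and is therefore a compact subset of the open ball.\<close>
  define K where "K = {x \<in> cball 0 R. \<theta> x ^ ?P \<le> 3 / 4}"
  have "compact K"
  proof -
    have "closed {x. \<theta> x ^ ?P \<le> 3 / 4}"
      by (intro closed_Collect_le cont_\<theta> continuous_on_const)
    moreover have "K = cball 0 R \<inter> {x. \<theta> x ^ ?P \<le> 3 / 4}" by (auto simp: K_def)
    ultimately show ?thesis by (simp add: compact_Int_closed)
  qed
  have "K \<subseteq> ?B"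
  proof
    fix x assume x: "x \<in> K"
    have "norm x \<noteq> R"
    proof
      assume "norm x = R"
      then have "\<theta> x = 1" using \<open>0 < R\<close> by (simp add: \<theta>_eq)
      then show False using x by (simp add: K_def)
    qed
    then show "x \<in> ?B" using x by (auto simp: K_def)
  qed
  have "x1 \<in> K" using x1 small by (simp add: K_def)
  have "continuous_on K \<phi>"
    unfolding \<phi>_eq by (intro continuous_intros cont_\<theta>)
  then have "lsc_on K (\<lambda>x. u x - \<phi> x)"
    using lsc_on_subset[OF lsc \<open>K \<subseteq> ?B\<close>] by (intro lsc_on_diff_continuous)
  then obtain x0 where x0: "x0 \<in> K" and min: "\<And>y. y \<in> K \<Longrightarrow> u x0 - \<phi> x0 \<le> u y - \<phi> y"
    using lsc_on_attains_inf[OF \<open>compact K\<close>] \<open>x1 \<in> K\<close> by blast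
  \<comment> \<open>The minimum over \<open>K\<close> is a minimum over the whole ball: off
    \<open>K\<close> the difference is at least \<open>- \<epsilon> / 4\<close>, while at
    \<open>x1\<close> it is below that, since \<open>u x1 < c + \<epsilon> / 2\<close> and
    \<open>\<phi> x1 > c + 3 * \<epsilon> / 4\<close>.\<close>
  have "u x0 - \<phi> x0 \<le> u y - \<phi> y" if "y \<in> ?B" for y
  proof (cases "y \<in> K")
    case False
    then have "3 / 4 < \<theta> y ^ ?P" using that by (auto simp: K_def)
    then have "\<epsilon> * (1 - \<theta> y ^ ?P) \<le> \<epsilon> * (1 / 4)" using \<open>\<epsilon> > 0\<close> by (intro mult_left_mono) auto
    then have "- (\<epsilon> / 4) \<le> u y - \<phi> y" using c_le[OF that] by (simp add: \<phi>_eq)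
    moreover have "\<epsilon> * (3 / 4) \<le> \<epsilon> * (1 - \<theta> x1 ^ ?P)"
      using \<open>\<epsilon> > 0\<close> small by (intro mult_left_mono) auto
    then have "u x1 - \<phi> x1 \<le> - (\<epsilon> / 4)" using x1 unfolding \<phi>_eq by argo
    ultimately show ?thesis using min[OF \<open>x1 \<in> K\<close>] by linarith
  qed (use min in blast)
  then have "local_min_at (\<lambda>x. u x - \<phi> x) x0"
    unfolding local_min_at_def eventually_nhds using x0 \<open>K \<subseteq> ?B\<close> by (intro exI[of _ ?B]) auto
  moreover note C2 = C2_near_radial(1)[OF dg dg' contg, of x0, folded \<phi>_def]
  ultimately have le: "Pk_plus k ((2 * g' (x0 \<bullet> x0)) *\<^sub>R mat 1 + (4 * g'' (x0 \<bullet> x0)) *\<^sub>R (\<chi> i j. x0 $ i * x0 $ j))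
      + b * norm ((2 * g' (x0 \<bullet> x0)) *\<^sub>R x0) \<le> - \<gamma>"
    using visc x0 \<open>K \<subseteq> ?B\<close> unfolding visc_le_def by fastforce
  \<comment> \<open>\<open>- a\<close> is the tangential eigenvalue of the Hessian at
    \<open>x0\<close>, and the gradient there is \<open>- a *\<^sub>R x0\<close>.\<close>
  define a where "a = - (2 * g' (x0 \<bullet> x0))"
  have a_eq: "a = 2 * \<epsilon> * \<rho> * real ?P * \<theta> x0 ^ Suc n"
    by (simp add: a_def g'_def \<theta>_def)
  have "a \<ge> 0" using \<open>\<epsilon> > 0\<close> \<open>\<rho> > 0\<close> \<theta>_nonneg[of x0] by (simp add: a_eq)
  have "- (real k * a) \<le> Pk_plus k ((2 * g' (x0 \<bullet> x0)) *\<^sub>R mat 1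
      + (4 * g'' (x0 \<bullet> x0)) *\<^sub>R (\<chi> i j. x0 $ i * x0 $ j))"
    by (rule Pk_plus_rank_one_perturbation[where y = x0 and e = "- (4 * g'' (x0 \<bullet> x0))"])
      (simp_all add: C2_near_radial(2)[OF dg dg' contg] a_def \<open>k < CARD('n)\<close>)
  moreover have norm_G: "norm ((2 * g' (x0 \<bullet> x0)) *\<^sub>R x0) = a * norm x0"
    using \<open>a \<ge> 0\<close> unfolding norm_scaleR by (simp add: a_def)
  ultimately have "\<gamma> \<le> a * (real k - b * norm x0)"
    using le unfolding norm_G by (simp add: algebra_simps)
  also have "\<dots> \<le> a * (real k * (1 - norm x0 / R))"
  proof (rule mult_left_mono)
    \<comment> \<open>Here the hypothesis \<open>real k \<le> b * R\<close> enters; equality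
      suffices.\<close>
    have "real k * (norm x0 / R) \<le> (b * R) * (norm x0 / R)"
      using assms by (intro mult_right_mono) auto
    also have "\<dots> = b * norm x0" using \<open>0 < R\<close> by simp
    finally show "real k - b * norm x0 \<le> real k * (1 - norm x0 / R)"
      by (simp add: right_diff_distrib)
  qed fact
  also have "\<dots> = 2 * \<epsilon> * \<rho> * real k * (real ?P * ((norm x0 / R) ^ (2 * Suc n) * (1 - norm x0 / R)))"
    unfolding a_eq \<theta>_eq power_mult by (simp only: mult_ac)
  also have "\<dots> \<le> 2 * \<epsilon> * \<rho> * real k * 1"
  proof (rule mult_left_mono)
    let ?s = "norm x0 / R"
    have s: "0 \<le> ?s" "?s \<le> 1" using x0 \<open>0 < R\<close> by (auto simp: K_def)
    \<comment> \<open>Squaring the radius doubles the exponent to \<open>2 * Suc n\<close>, and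
      \<open>?P = n + 2\<close> is at most the factor \<open>2 * n + 3\<close> that the power
      estimate allows.\<close>
    have "real ?P * (?s ^ (2 * Suc n) * (1 - ?s)) \<le> real (Suc (2 * Suc n)) * (?s ^ (2 * Suc n) * (1 - ?s))"
      using s by (intro mult_right_mono mult_nonneg_nonneg zero_le_power) auto
    also have "\<dots> \<le> 1" by (rule power_times_one_minus_le[OF s])
    finally show "real ?P * (?s ^ (2 * Suc n) * (1 - ?s)) \<le> 1" .
  qed (use \<open>\<epsilon> > 0\<close> \<open>\<rho> > 0\<close> in auto)
  also have "\<dots> = \<gamma> * (real k / (2 * (real k + 1)))"
    using \<open>0 < R\<close> by (simp add: \<epsilon>_def \<rho>_def field_simps)
  also have "\<dots> < \<gamma> * 1"
    using \<open>0 < \<gamma>\<close> by (intro mult_strict_left_mono) (auto simp: divide_less_eq)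
  finally show False by simp
qed

subsection \<open>Second-order conditions at a maximum\<close>

text \<open>The mean value theorem along \<open>h\<close>, applied to the difference of
  \<open>\<phi>\<close> on two parallel sides of a parallelogram, leaves a difference of gradients,
  which is linearised at \<open>x0\<close>. Symmetry of \<open>A\<close> is not assumed, since this
  estimate serves to prove it.\<close>

lemma second_difference_approx:
  fixes \<phi> :: "real ^ 'n \<Rightarrow> real" and A :: "real ^ 'n ^ 'n"
  assumes "open U" "x0 \<in> U" and G: "\<And>x. x \<in> U \<Longrightarrow> GDERIV \<phi> x :> G x"
    and A: "(G has_derivative (\<lambda>h. A *v h)) (at x0)" and "0 < e"
  shows "\<exists>\<delta>>0. \<forall>s. 0 < s \<and> s < \<delta> \<longrightarrow>
    \<bar>\<phi> (x0 + s *\<^sub>R h + s *\<^sub>R k) - \<phi> (x0 + s *\<^sub>R h) - \<phi> (x0 + s *\<^sub>R k) + \<phi> x0 - s\<^sup>2 * (h \<bullet> (A *v k))\<bar>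
      \<le> e * s\<^sup>2"
proof -
  \<comment> \<open>The parallelogram of size \<open>s\<close> lies within \<open>s * M\<close> of
    \<open>x0\<close>. \<open>\<eta>\<close> makes the total error
    \<open>M * (2 * (\<eta> * (s * M)))\<close> equal to \<open>s * e\<close>, and
    \<open>\<delta>\<close> keeps the parallelogram in \<open>U\<close> and in the range of the
    linearisation.\<close>
  define M where "M = norm h + norm k + 1"
  have "M > 0" by (simp add: M_def add_nonneg_pos)
  define \<eta> where "\<eta> = e / (2 * M\<^sup>2)"
  have "\<eta> > 0" using \<open>0 < e\<close> \<open>M > 0\<close> by (simp add: \<eta>_def)
  obtain d where "d > 0" and d: "\<And>y. norm (y - x0) < d \<Longrightarrow> norm (G y - G x0 - A *v (y - x0)) \<le> \<eta> * norm (y - x0)"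
    using A \<open>\<eta> > 0\<close> unfolding has_derivative_at_alt by blast
  obtain r where "r > 0" and r: "ball x0 r \<subseteq> U"
    using assms(1,2) open_contains_ball by blast
  define \<delta> where "\<delta> = min d r / M"
  have "\<delta> > 0" using \<open>d > 0\<close> \<open>r > 0\<close> \<open>M > 0\<close> by (simp add: \<delta>_def)
  have "\<bar>\<phi> (x0 + s *\<^sub>R h + s *\<^sub>R k) - \<phi> (x0 + s *\<^sub>R h) - \<phi> (x0 + s *\<^sub>R k) + \<phi> x0 - s\<^sup>2 * (h \<bullet> (A *v k))\<bar>
      \<le> e * s\<^sup>2" if s: "0 < s" "s < \<delta>" for s
  proof -
    have sM: "s * M < d" "s * M < r"
      using s \<open>M > 0\<close> by (auto simp: \<delta>_def pos_less_divide_eq)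
    have near: "norm ((\<tau> * s) *\<^sub>R h + c *\<^sub>R (s *\<^sub>R k)) \<le> s * M" if "0 \<le> \<tau>" "\<tau> \<le> 1" "0 \<le> c" "c \<le> 1" for \<tau> c
    proof -
      have "norm ((\<tau> * s) *\<^sub>R h + c *\<^sub>R (s *\<^sub>R k)) \<le> \<tau> * (s * norm h) + c * (s * norm k)"
        using that s by (intro order_trans[OF norm_triangle_ineq]) (simp add: mult.assoc)
      also have "\<dots> \<le> 1 * (s * norm h) + 1 * (s * norm k)"
        using that s by (intro add_mono mult_right_mono) auto
      also have "\<dots> \<le> s * M" using s by (simp add: M_def algebra_simps)
      finally show ?thesis .
    qed
    have inU: "x0 + ((\<tau> * s) *\<^sub>R h + c *\<^sub>R (s *\<^sub>R k)) \<in> U" if "0 \<le> \<tau>" "\<tau> \<le> 1" "0 \<le> c" "c \<le> 1" for \<tau> c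
    proof (rule subsetD[OF r])
      have "dist x0 (x0 + v) = norm v" for v by (simp add: dist_norm)
      then show "x0 + ((\<tau> * s) *\<^sub>R h + c *\<^sub>R (s *\<^sub>R k)) \<in> ball x0 r"
        using near[OF that] sM by simp
    qed
    \<comment> \<open>\<open>c = 0\<close> and \<open>c = 1\<close> parametrise the two sides
      parallel to \<open>h\<close>, so that \<open>\<psi> 1 - \<psi> 0\<close> is the second
      difference.\<close>
    define p where "p c \<tau> = x0 + ((\<tau> * s) *\<^sub>R h + c *\<^sub>R (s *\<^sub>R k))" for c \<tau>
    define \<psi> where "\<psi> \<tau> = \<phi> (p 1 \<tau>) - \<phi> (p 0 \<tau>)" for \<tau>
    have dp: "((\<lambda>\<tau>. \<phi> (p c \<tau>)) has_derivative (\<lambda>y. (y * s) *\<^sub>R h \<bullet> G (p c \<tau>))) (at \<tau>)"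
      if "0 \<le> \<tau>" "\<tau> \<le> 1" "0 \<le> c" "c \<le> 1" for c \<tau>
    proof -
      have "(p c has_derivative (\<lambda>y. (y * s) *\<^sub>R h)) (at \<tau>)"
        unfolding p_def[abs_def] by (rule has_derivative_eq_rhs, (rule derivative_intros)+) simp
      moreover have "(\<phi> has_derivative (\<lambda>h. h \<bullet> G (p c \<tau>))) (at (p c \<tau>))"
        using G[OF inU[OF that]] by (simp add: gderiv_def p_def)
      ultimately show ?thesis by (rule has_derivative_compose)
    qed
    have d\<psi>: "(\<psi> has_derivative (\<lambda>y. (y * s) *\<^sub>R h \<bullet> G (p 1 \<tau>) - (y * s) *\<^sub>R h \<bullet> G (p 0 \<tau>))) (at \<tau>)"
      if "0 \<le> \<tau>" "\<tau> \<le> 1" for \<tau>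
      unfolding \<psi>_def[abs_def] using that by (intro has_derivative_diff dp) auto
    obtain \<tau> where \<tau>: "0 < \<tau>" "\<tau> < 1"
      and "\<psi> 1 - \<psi> 0 = ((1 - 0) * s) *\<^sub>R h \<bullet> G (p 1 \<tau>) - ((1 - 0) * s) *\<^sub>R h \<bullet> G (p 0 \<tau>)"
    proof (rule mvt[of 0 1 \<psi> "\<lambda>\<tau> y. (y * s) *\<^sub>R h \<bullet> G (p 1 \<tau>) - (y * s) *\<^sub>R h \<bullet> G (p 0 \<tau>)"])
      show "continuous_on {0..1} \<psi>"
        using d\<psi> by (intro has_derivative_continuous_on[of _ \<psi>])
          (auto intro: has_derivative_at_withinI)
    qed (use d\<psi> in auto)
    then have diff: "\<psi> 1 - \<psi> 0 = s * (h \<bullet> (G (p 1 \<tau>) - G (p 0 \<tau>)))"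
      by (simp add: inner_diff_right right_diff_distrib)
    define E where "E c = G (p c \<tau>) - G x0 - A *v (p c \<tau> - x0)" for c
    have E: "norm (E c) \<le> \<eta> * (s * M)" if "0 \<le> c" "c \<le> 1" for c
    proof -
      have "norm (p c \<tau> - x0) \<le> s * M" using near[of \<tau> c] that \<tau> by (simp add: p_def)
      moreover from this sM have "norm (E c) \<le> \<eta> * norm (p c \<tau> - x0)"
        unfolding E_def by (intro d) auto
      ultimately show ?thesis using \<open>\<eta> > 0\<close> by (smt (verit) mult_left_mono)
    qed
    have "p 1 \<tau> - x0 = (p 0 \<tau> - x0) + s *\<^sub>R k" by (simp add: p_def)
    then have "A *v (p 1 \<tau> - x0) = A *v (p 0 \<tau> - x0) + s *\<^sub>R (A *v k)"
      by (simp only: matrix_vector_right_distrib matrix_vector_mult_scaleR)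
    then have G_diff: "G (p 1 \<tau>) - G (p 0 \<tau>) = s *\<^sub>R (A *v k) + (E 1 - E 0)"
      by (simp add: E_def)
    have "\<psi> 1 - \<psi> 0 - s\<^sup>2 * (h \<bullet> (A *v k)) = s * (h \<bullet> (E 1 - E 0))"
      unfolding diff G_diff by (simp add: inner_add_right distrib_left power2_eq_square)
    moreover have "\<bar>s * (h \<bullet> (E 1 - E 0))\<bar> \<le> e * s\<^sup>2"
    proof -
      have "\<bar>h \<bullet> (E 1 - E 0)\<bar> \<le> norm h * norm (E 1 - E 0)" by (rule Cauchy_Schwarz_ineq2)
      also have "\<dots> \<le> M * (2 * (\<eta> * (s * M)))"
      proof (rule mult_mono)
        show "norm (E 1 - E 0) \<le> 2 * (\<eta> * (s * M))"
          using E[of 1] E[of 0] norm_triangle_ineq4[of "E 1" "E 0"] by simp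
      qed (use \<open>M > 0\<close> in \<open>auto simp: M_def\<close>)
      also have "\<dots> = s * e" using \<open>M > 0\<close> by (simp add: \<eta>_def power2_eq_square)
      finally have "s * \<bar>h \<bullet> (E 1 - E 0)\<bar> \<le> s * (s * e)" using s by (intro mult_left_mono) auto
      then show ?thesis using s by (simp add: abs_mult power2_eq_square mult_ac)
    qed
    moreover have "\<psi> 1 - \<psi> 0 = \<phi> (x0 + s *\<^sub>R h + s *\<^sub>R k) - \<phi> (x0 + s *\<^sub>R h) - \<phi> (x0 + s *\<^sub>R k) + \<phi> x0"
      by (simp add: \<psi>_def p_def add.assoc)
    ultimately show ?thesis by simp
  qed
  with \<open>\<delta> > 0\<close> show ?thesis by blast
qed

text \<open>The second difference is unchanged when \<open>h\<close> and \<open>k\<close> are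
  swapped, yet it approximates both bilinear values up to an arbitrarily small multiple of
  \<open>s\<^sup>2\<close>.\<close>

lemma C2_near_Hessian_symmetric:
  assumes "C2_near \<phi> x0 G H"
  shows "(H x0 *v h) \<bullet> k = h \<bullet> (H x0 *v k)"
proof -
  obtain U where U: "open U" "x0 \<in> U" "\<And>x. x \<in> U \<Longrightarrow> GDERIV \<phi> x :> G x"
    and H: "(G has_derivative (\<lambda>h. H x0 *v h)) (at x0)"
    using assms unfolding C2_near_def by blast
  define D where "D = h \<bullet> (H x0 *v k) - k \<bullet> (H x0 *v h)"
  have "\<bar>D\<bar> \<le> e" if "e > 0" for e
  proof -
    from \<open>e > 0\<close> have "e / 2 > 0" by simp
    note approx = second_difference_approx[OF U H this]
    obtain \<delta>1 where "\<delta>1 > 0" and 1: "\<And>s. 0 < s \<Longrightarrow> s < \<delta>1 \<Longrightarrow>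
      \<bar>\<phi> (x0 + s *\<^sub>R h + s *\<^sub>R k) - \<phi> (x0 + s *\<^sub>R h) - \<phi> (x0 + s *\<^sub>R k) + \<phi> x0 - s\<^sup>2 * (h \<bullet> (H x0 *v k))\<bar>
      \<le> e / 2 * s\<^sup>2"
      using approx[of h k] by blast
    obtain \<delta>2 where "\<delta>2 > 0" and 2: "\<And>s. 0 < s \<Longrightarrow> s < \<delta>2 \<Longrightarrow>
      \<bar>\<phi> (x0 + s *\<^sub>R k + s *\<^sub>R h) - \<phi> (x0 + s *\<^sub>R k) - \<phi> (x0 + s *\<^sub>R h) + \<phi> x0 - s\<^sup>2 * (k \<bullet> (H x0 *v h))\<bar>
      \<le> e / 2 * s\<^sup>2"
      using approx[of k h] by blast
    define s where "s = min \<delta>1 \<delta>2 / 2"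
    have s: "0 < s" "s < \<delta>1" "s < \<delta>2" using \<open>\<delta>1 > 0\<close> \<open>\<delta>2 > 0\<close> by (auto simp: s_def)
    have "x0 + s *\<^sub>R k + s *\<^sub>R h = x0 + s *\<^sub>R h + s *\<^sub>R k" by (simp add: algebra_simps)
    note 1[OF s(1,2)] 2[OF s(1,3), unfolded this]
    then
    have "\<bar>s\<^sup>2 * (h \<bullet> (H x0 *v k)) - s\<^sup>2 * (k \<bullet> (H x0 *v h))\<bar> \<le> e / 2 * s\<^sup>2 + e / 2 * s\<^sup>2"
      by argo
    moreover have "s\<^sup>2 * (h \<bullet> (H x0 *v k)) - s\<^sup>2 * (k \<bullet> (H x0 *v h)) = s\<^sup>2 * D"
      by (simp add: D_def right_diff_distrib)
    ultimately have "s\<^sup>2 * \<bar>D\<bar> \<le> s\<^sup>2 * e"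
      by (simp add: abs_mult mult.commute)
    then show ?thesis using s by (simp add: mult_le_cancel_left)
  qed
  then have "D = 0" using field_le_epsilon[of "\<bar>D\<bar>" 0] by simp
  then show ?thesis by (simp add: D_def inner_commute)
qed

text \<open>If the curvature along \<open>h\<close> were positive, the directional derivative
  \<open>q\<close>, which vanishes at 0, would be positive just to the right of 0, and the mean
  value theorem would give a value above the maximum.\<close>

lemma C2_near_local_max:
  assumes C2: "C2_near \<phi> x0 G H" and max: "\<forall>\<^sub>F x in nhds x0. \<phi> x \<le> \<phi> x0"
  shows "G x0 = 0" and "h \<bullet> (H x0 *v h) \<le> 0"
proof -
  obtain U where U: "open U" "x0 \<in> U" "\<And>x. x \<in> U \<Longrightarrow> GDERIV \<phi> x :> G x"
    and H: "(G has_derivative (\<lambda>h. H x0 *v h)) (at x0)"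
    using C2 unfolding C2_near_def by blast
  obtain V where V: "open V" "x0 \<in> V" "\<And>x. x \<in> V \<Longrightarrow> \<phi> x \<le> \<phi> x0"
    using max unfolding eventually_nhds by blast
  have "(\<phi> has_derivative (\<lambda>h. h \<bullet> G x0)) (at x0)"
    using U by (simp add: gderiv_def)
  then have "(\<lambda>h. h \<bullet> G x0) = (\<lambda>h. 0)"
    using V by (intro differential_zero_maxmin[of x0 V \<phi>]) auto
  then show G0: "G x0 = 0" by (metis inner_eq_zero_iff)
  show "h \<bullet> (H x0 *v h) \<le> 0"
  proof (rule ccontr)
    assume curv: "\<not> h \<bullet> (H x0 *v h) \<le> 0"
    define q where "q t = h \<bullet> G (x0 + t *\<^sub>R h)" for t
    have "((\<lambda>t. x0 + t *\<^sub>R h) has_derivative (\<lambda>t. t *\<^sub>R h)) (at 0)"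
      by (rule has_derivative_eq_rhs, (rule derivative_intros)+) simp
    moreover have "(G has_derivative (\<lambda>h. H x0 *v h)) (at (x0 + 0 *\<^sub>R h))" using H by simp
    ultimately have "((\<lambda>t. G (x0 + t *\<^sub>R h)) has_derivative (\<lambda>t. H x0 *v (t *\<^sub>R h))) (at 0)"
      by (rule has_derivative_compose)
    then have "(q has_derivative (\<lambda>t. h \<bullet> (H x0 *v (t *\<^sub>R h)))) (at 0)"
      unfolding q_def[abs_def] by (rule has_derivative_inner_right)
    then have "(q has_real_derivative h \<bullet> (H x0 *v h)) (at 0)"
      by (simp add: has_field_derivative_def matrix_vector_mult_scaleR mult_commute_abs)
    then obtain d where "d > 0" and d: "\<And>t. 0 < t \<Longrightarrow> t < d \<Longrightarrow> q 0 < q (0 + t)"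
      using DERIV_pos_inc_right[of q "h \<bullet> (H x0 *v h)" 0] curv by force
    have "q 0 = 0" using G0 by (simp add: q_def)
    have "open (U \<inter> V)" "x0 \<in> U \<inter> V" using U V by auto
    then obtain r where "r > 0" and r: "ball x0 r \<subseteq> U \<inter> V"
      using open_contains_ball by blast
    \<comment> \<open>The step stays below \<open>d\<close>, where \<open>q\<close> is positive, and
      keeps the segment inside the ball of radius \<open>r\<close>; the added 1 covers
      \<open>h = 0\<close>.\<close>
    define s where "s = min (d / 2) (r / (norm h + 1) / 2)"
    have "s > 0" "s < d"
      using \<open>d > 0\<close> \<open>r > 0\<close> by (auto simp: s_def add_nonneg_pos)
    have in_ball: "x0 + t *\<^sub>R h \<in> ball x0 r" if "0 \<le> t" "t \<le> s" for t
    proof -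
      have "t * norm h \<le> s * norm h" using that by (intro mult_right_mono) auto
      also have "\<dots> < s * (norm h + 1)" using \<open>s > 0\<close> by simp
      also have "\<dots> \<le> r / (norm h + 1) / 2 * (norm h + 1)"
        by (intro mult_right_mono) (auto simp: s_def)
      also have "\<dots> = r / 2"
      proof -
        have "r / m / 2 * m = r / 2" if "m > 0" for m using that by simp
        from this[of "norm h + 1"] show ?thesis by (simp only: add_nonneg_pos norm_ge_zero zero_less_one)
      qed
      finally show ?thesis using that \<open>r > 0\<close> by (simp add: dist_norm)
    qed
    have "((\<lambda>t. \<phi> (x0 + t *\<^sub>R h)) has_derivative (\<lambda>y. y * q t)) (at t)" if "0 \<le> t" "t \<le> s" for t
    proof -
      have "((\<lambda>t. x0 + t *\<^sub>R h) has_derivative (\<lambda>t. t *\<^sub>R h)) (at t)"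
        by (rule has_derivative_eq_rhs, (rule derivative_intros)+) simp
      moreover have "(\<phi> has_derivative (\<lambda>y. y \<bullet> G (x0 + t *\<^sub>R h))) (at (x0 + t *\<^sub>R h))"
        using U(3) in_ball[OF that] r by (auto simp: gderiv_def)
      ultimately have "((\<lambda>t. \<phi> (x0 + t *\<^sub>R h)) has_derivative (\<lambda>y. (y *\<^sub>R h) \<bullet> G (x0 + t *\<^sub>R h))) (at t)"
        by (rule has_derivative_compose)
      then show ?thesis by (simp add: q_def)
    qed
    note deriv = this
    obtain t where t: "0 < t" "t < s" and "\<phi> (x0 + s *\<^sub>R h) - \<phi> (x0 + 0 *\<^sub>R h) = (s - 0) * q t"
    proof (rule mvt[of 0 s "\<lambda>t. \<phi> (x0 + t *\<^sub>R h)" "\<lambda>t y. y * q t"])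
      show "continuous_on {0..s} (\<lambda>t. \<phi> (x0 + t *\<^sub>R h))"
        using deriv by (intro has_derivative_continuous_on) (auto intro: has_derivative_at_withinI)
    qed (use deriv \<open>s > 0\<close> in auto)
    moreover have "q t > 0" using d[of t] t \<open>s < d\<close> \<open>q 0 = 0\<close> by simp
    ultimately have "\<phi> (x0 + s *\<^sub>R h) > \<phi> x0" using \<open>s > 0\<close> by (simp add: algebra_simps)
    moreover have "x0 + s *\<^sub>R h \<in> V" using in_ball[of s] r \<open>s > 0\<close> by auto
    ultimately show False using V(3) by force
  qed
qed

subsection \<open>The principal eigenvalues\<close>

text \<open>A test function touching a constant from below has a local maximum, so its gradient
  vanishes and its Hessian is negative semidefinite. This makes \<open>\<mu> = 0\<close> admissible
  in both suprema.\<close>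

lemma visc_le_const:
  fixes \<Omega> :: "(real ^ 'n) set"
  assumes "k \<le> CARD('n)"
  shows "visc_le k b 0 0 \<Omega> (\<lambda>x. c)"
  unfolding visc_le_def
proof (intro ballI allI impI)
  fix x0 and \<phi> :: "real ^ 'n \<Rightarrow> real" and G H
  assume C2: "C2_near \<phi> x0 G H" and "local_min_at (\<lambda>x. c - \<phi> x) x0"
  then have "\<forall>\<^sub>F x in nhds x0. \<phi> x \<le> \<phi> x0" by (simp add: local_min_at_def)
  note max = C2_near_local_max[OF C2 this]
  have "Pk_plus k (H x0) \<le> 0"
  proof (rule Pk_plus_nonpos)
    show "(H x0 *v x) \<bullet> y = x \<bullet> (H x0 *v y)" for x y by (rule C2_near_Hessian_symmetric[OF C2])
    show "x \<bullet> (H x0 *v x) \<le> 0" for x by (rule max(2))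
  qed fact
  then show "Pk_plus k (H x0) + b * norm (G x0) + 0 * c \<le> 0" by (simp add: max(1))
qed

text \<open>On the open ball the infimum of \<open>\<psi>\<close> might be 0. The strict inequality
  leaves room for a smaller radius \<open>r\<close>, midway between \<open>k / b\<close> and
  \<open>R\<close>, on whose closed ball \<open>\<psi>\<close> has a positive minimum.\<close>

lemma no_positive_eigenvalue_on_ball:
  fixes \<psi> :: "real ^ 'n \<Rightarrow> real"
  assumes "k < CARD('n)" "0 < R" "real k < b * R" "0 < \<mu>"
    and lsc: "lsc_on (ball 0 R) \<psi>" and pos: "\<And>x. x \<in> ball 0 R \<Longrightarrow> 0 < \<psi> x"
    and visc: "visc_le k b \<mu> 0 (ball 0 R) \<psi>"
  shows False
proof -
  have "b > 0"
    using \<open>real k < b * R\<close> \<open>0 < R\<close> by (metis less_le_trans of_nat_0_le_iff order_le_less_trans zero_less_mult_pos2)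
  define r where "r = (k / b + R) / 2"
  have "k / b < R" using \<open>b > 0\<close> \<open>real k < b * R\<close> by (simp add: divide_less_eq mult.commute)
  then have r: "0 < r" "r < R" "real k \<le> b * r"
    using \<open>b > 0\<close> \<open>0 < R\<close> by (auto simp: r_def field_simps intro: add_nonneg_pos)
  have sub: "cball 0 r \<subseteq> (ball 0 R :: (real ^ 'n) set)" "ball 0 r \<subseteq> (ball 0 R :: (real ^ 'n) set)"
    using r by auto
  obtain z where z: "z \<in> cball 0 r" "\<And>y. y \<in> cball 0 r \<Longrightarrow> \<psi> z \<le> \<psi> y"
    using lsc_on_attains_inf[OF compact_cball _ lsc_on_subset[OF lsc sub(1)]] r by auto
  have "\<psi> z > 0" using z(1) sub pos by blast
  have "visc_le k b 0 (- (\<mu> * \<psi> z)) (ball 0 r) \<psi>"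
    unfolding visc_le_def
  proof (intro ballI allI impI)
    fix x0 \<phi> G H
    assume x0: "x0 \<in> ball 0 r" and "C2_near \<phi> x0 G H" "local_min_at (\<lambda>x. \<psi> x - \<phi> x) x0"
    then have "Pk_plus k (H x0) + b * norm (G x0) + \<mu> * \<psi> x0 \<le> 0"
      using visc sub(2) unfolding visc_le_def by blast
    moreover have "\<mu> * \<psi> z \<le> \<mu> * \<psi> x0" using z(2)[of x0] x0 \<open>0 < \<mu>\<close> by simp
    ultimately show "Pk_plus k (H x0) + b * norm (G x0) + 0 * \<psi> x0 \<le> - (\<mu> * \<psi> z)" by simp
  qed
  then show False
    using no_supersolution_on_ball[of k r b "\<mu> * \<psi> z" \<psi> "\<psi> z"] r z \<open>k < CARD('n)\<close> \<open>0 < \<mu>\<close> \<open>\<psi> z > 0\<close>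
      lsc_on_subset[OF lsc sub(2)] by auto
qed

theorem corollary18:
  fixes k :: nat and b R :: real and \<Omega> :: "(real ^ 'n) set"
  assumes "1 \<le> k" and "k < CARD('n)"
    and "0 < R"
    and "open \<Omega>" and "connected \<Omega>" and "bounded \<Omega>"
    and "ball 0 R \<subseteq> \<Omega>"
  shows "(b * R \<ge> real k \<longrightarrow>
            \<not> (\<exists>u. lsc_on \<Omega> u \<and> (\<forall>x\<in>\<Omega>. 0 < u x) \<and> visc_le k b 0 (-1) \<Omega> u)) \<and>
         (b * R > real k \<longrightarrow>
            \<not> (\<exists>\<mu> \<psi>. 0 < \<mu> \<and> lsc_on \<Omega> \<psi> \<and> visc_le k b \<mu> 0 \<Omega> \<psi> \<and> (\<forall>x\<in>\<Omega>. 0 < \<psi> x)) \<and>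
            mu_bar_plus k b \<Omega> = 0 \<and> mu_plus k b \<Omega> = 0)"
proof (intro conjI impI)
  assume "b * R \<ge> real k"
  then show "\<not> (\<exists>u. lsc_on \<Omega> u \<and> (\<forall>x\<in>\<Omega>. 0 < u x) \<and> visc_le k b 0 (-1) \<Omega> u)"
    using no_supersolution_on_ball[of k R b 1 _ 0] assms
    by (meson lsc_on_subset visc_le_subset less_imp_le subset_iff zero_less_one)
next
  assume "b * R > real k"
  then show none: "\<not> (\<exists>\<mu> \<psi>. 0 < \<mu> \<and> lsc_on \<Omega> \<psi> \<and> visc_le k b \<mu> 0 \<Omega> \<psi> \<and> (\<forall>x\<in>\<Omega>. 0 < \<psi> x))"
    using no_positive_eigenvalue_on_ball[of k R b] assms
    by (meson lsc_on_subset visc_le_subset subset_iff)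
  \<comment> \<open>The supremum of an empty set of \<open>ereal\<close> would be minus infinity, so
    the lower bound 0 needs a witness: the constant 1 with \<open>\<mu> = 0\<close>.\<close>
  have const: "visc_le k b 0 0 \<Omega> (\<lambda>x. 1)"
    using assms(2) by (intro visc_le_const) simp
  show "mu_bar_plus k b \<Omega> = 0"
    unfolding mu_bar_plus_def
  proof (rule antisym)
    show "(SUP \<mu>\<in>{\<mu>. \<exists>\<phi>. lsc_on (closure \<Omega>) \<phi> \<and> (\<forall>x\<in>closure \<Omega>. 0 < \<phi> x) \<and> visc_le k b \<mu> 0 \<Omega> \<phi>}. ereal \<mu>) \<le> 0"
    proof (rule SUP_least)
      fix \<mu> assume "\<mu> \<in> {\<mu>. \<exists>\<phi>. lsc_on (closure \<Omega>) \<phi> \<and> (\<forall>x\<in>closure \<Omega>. 0 < \<phi> x) \<and> visc_le k b \<mu> 0 \<Omega> \<phi>}"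
      \<comment> \<open>A function admissible on the closure restricts to one admissible on
        \<open>\<Omega>\<close>, so a positive \<open>\<mu>\<close> is already excluded.\<close>
      then have "\<not> 0 < \<mu>"
        using none closure_subset[of \<Omega>] by (blast intro: lsc_on_subset)
      then show "ereal \<mu> \<le> 0" by simp
    qed
    show "0 \<le> (SUP \<mu>\<in>{\<mu>. \<exists>\<phi>. lsc_on (closure \<Omega>) \<phi> \<and> (\<forall>x\<in>closure \<Omega>. 0 < \<phi> x) \<and> visc_le k b \<mu> 0 \<Omega> \<phi>}. ereal \<mu>)"
      using const by (intro SUP_upper2[of 0]) (auto intro!: exI[of _ "\<lambda>x. 1"] lsc_on_const)
  qed
  show "mu_plus k b \<Omega> = 0"
    unfolding mu_plus_def
  proof (rule antisym)
    show "(SUP \<mu>\<in>{\<mu>. \<exists>\<phi>. lsc_on \<Omega> \<phi> \<and> (\<forall>x\<in>\<Omega>. 0 < \<phi> x) \<and> visc_le k b \<mu> 0 \<Omega> \<phi>}. ereal \<mu>) \<le> 0"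
      using none by (intro SUP_least) (force simp: not_less)
    show "0 \<le> (SUP \<mu>\<in>{\<mu>. \<exists>\<phi>. lsc_on \<Omega> \<phi> \<and> (\<forall>x\<in>\<Omega>. 0 < \<phi> x) \<and> visc_le k b \<mu> 0 \<Omega> \<phi>}. ereal \<mu>)"
      using const by (intro SUP_upper2[of 0]) (auto intro!: exI[of _ "\<lambda>x. 1"] lsc_on_const)
  qed
qed

end
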